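(* Let $R$ be a Bézout domain satisfying the $IP_2$ property. If $R$ has the $GE_2$ property, then every singular square matrix (of any size $n\times n$) over $R$ is a product of idempotent matrices. In particular, a Bézout domain with stable range $1$ has the $IP$ property.
   Context: All rings are nonzero, associative, with identity $1$, and need not be commutative. A domain is a (not necessarily commutative) nonzero ring without zero divisors. A ring is right (left) Bézout if every finitely generated right (left) ideal is principal; Bézout means both right and left Bézout. An element $a$ of a ring is right singular if $r.ann(a)\neq0$ and left singular if $l.ann(a)\neq 0$ (nonzero right, resp. left, annihilator), and singular if it is both; a square matrix in $M_n(R)$ is singular if it is a singular element of the ring $M_n(R)$. A ring $R$ has the $IP_2$ property if every $2\times2$ singular matrix over $R$ is a product of idempotent matrices, and the $IP$ property if every singular square matrix over $R$ (of any size) is a product of idempotent matrices. An $n\times n$ matrix is elementary if it is of the form $I_n+ce_{ij}$ with $c\in R$, $i\ne j$. $R$ is $GE_2$ (has the $GE_2$ property) if every invertible $2\times 2$ matrix over $R$ is a product of elementary matrices and diagonal matrices with invertible diagonal entries. $R$ has stable range $1$ if for any $a,b\in R$ with $aR+bR=R$ there exists $x\in R$ such that $a+bx$ is invertible. *)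

theory Defs
  imports Complex_Main "Jordan_Normal_Form.Matrix"
begin

definition right_ideal :: "'a::ring_1 set \<Rightarrow> bool" where
  "right_ideal I \<longleftrightarrow> 0 \<in> I \<and> (\<forall>x\<in>I. \<forall>y\<in>I. x + y \<in> I) \<and> (\<forall>x\<in>I. \<forall>r. x * r \<in> I)"

definition left_ideal :: "'a::ring_1 set \<Rightarrow> bool" where
  "left_ideal I \<longleftrightarrow> 0 \<in> I \<and> (\<forall>x\<in>I. \<forall>y\<in>I. x + y \<in> I) \<and> (\<forall>x\<in>I. \<forall>r. r * x \<in> I)"

text \<open>\<open>right_ideal hull S\<close> is the smallest right ideal containing \<open>S\<close>.\<close>

definition right_bezout :: "'a::ring_1 itself \<Rightarrow> bool" where
  "right_bezout _ \<longleftrightarrow>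
     (\<forall>S :: 'a set. finite S \<longrightarrow> (\<exists>a. right_ideal hull S = right_ideal hull {a}))"

definition left_bezout :: "'a::ring_1 itself \<Rightarrow> bool" where
  "left_bezout _ \<longleftrightarrow>
     (\<forall>S :: 'a set. finite S \<longrightarrow> (\<exists>a. left_ideal hull S = left_ideal hull {a}))"

definition bezout :: "'a::ring_1 itself \<Rightarrow> bool" where
  "bezout R \<longleftrightarrow> right_bezout R \<and> left_bezout R"

text \<open>Two-sided invertibility; the ring need not be commutative, so \<open>x dvd 1\<close> would only
  express the existence of a right inverse.\<close>

definition invertible_elem :: "'a::ring_1 \<Rightarrow> bool" where
  "invertible_elem x \<longleftrightarrow> (\<exists>y. x * y = 1 \<and> y * x = 1)"

definition stable_range_1 :: "'a::ring_1 itself \<Rightarrow> bool" where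
  "stable_range_1 _ \<longleftrightarrow>
     (\<forall>a b :: 'a. {a * r + b * s | r s. True} = UNIV \<longrightarrow> (\<exists>x. invertible_elem (a + b * x)))"

text \<open>Annihilators are taken in the ring of \<open>n \<times> n\<close> matrices. For \<open>n = 0\<close> that ring is zero,
  so no \<open>0 \<times> 0\<close> matrix is singular.\<close>

definition right_singular_mat :: "nat \<Rightarrow> 'a::ring_1 mat \<Rightarrow> bool" where
  "right_singular_mat n A \<longleftrightarrow> (\<exists>B \<in> carrier_mat n n. B \<noteq> 0\<^sub>m n n \<and> A * B = 0\<^sub>m n n)"

definition left_singular_mat :: "nat \<Rightarrow> 'a::ring_1 mat \<Rightarrow> bool" where
  "left_singular_mat n A \<longleftrightarrow> (\<exists>B \<in> carrier_mat n n. B \<noteq> 0\<^sub>m n n \<and> B * A = 0\<^sub>m n n)"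

definition singular_mat :: "nat \<Rightarrow> 'a::ring_1 mat \<Rightarrow> bool" where
  "singular_mat n A \<longleftrightarrow> right_singular_mat n A \<and> left_singular_mat n A"

definition product_of :: "nat \<Rightarrow> 'a::ring_1 mat set \<Rightarrow> 'a mat \<Rightarrow> bool" where
  "product_of n S A \<longleftrightarrow> (\<exists>As. set As \<subseteq> S \<and> A = foldr (*) As (1\<^sub>m n))"

definition idempotent_mats :: "nat \<Rightarrow> 'a::ring_1 mat set" where
  "idempotent_mats n = {E \<in> carrier_mat n n. E * E = E}"

definition elementary_mats :: "nat \<Rightarrow> 'a::ring_1 mat set" where
  "elementary_mats n =
     {1\<^sub>m n + mat n n (\<lambda>(k, l). if k = i \<and> l = j then c else 0) | c i j.
        i < n \<and> j < n \<and> i \<noteq> j}"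

definition invertible_diagonal_mats :: "nat \<Rightarrow> 'a::ring_1 mat set" where
  "invertible_diagonal_mats n =
     {D \<in> carrier_mat n n. diagonal_mat D \<and> (\<forall>i<n. invertible_elem (D $$ (i, i)))}"

definition IP_size :: "'a::ring_1 itself \<Rightarrow> nat \<Rightarrow> bool" where
  "IP_size _ n \<longleftrightarrow>
     (\<forall>A :: 'a mat. A \<in> carrier_mat n n \<and> singular_mat n A \<longrightarrow>
        product_of n (idempotent_mats n) A)"

definition IP_2 :: "'a::ring_1 itself \<Rightarrow> bool" where
  "IP_2 R \<longleftrightarrow> IP_size R 2"

definition IP :: "'a::ring_1 itself \<Rightarrow> bool" where
  "IP R \<longleftrightarrow> (\<forall>n. IP_size R n)"

definition GE_2 :: "'a::ring_1 itself \<Rightarrow> bool" where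
  "GE_2 _ \<longleftrightarrow>
     (\<forall>A :: 'a mat. A \<in> carrier_mat 2 2 \<and> invertible_mat A \<longrightarrow>
        product_of 2 (elementary_mats 2 \<union> invertible_diagonal_mats 2) A)"

end

theory Submission
  imports Defs
begin

text \<open>
  Write \<open>J\<close> for the projection \<open>diag(1, \<dots>, 1, 0)\<close>. Everything rests on the set of invertible
  matrices \<open>U\<close> for which \<open>U J\<close> is a product of idempotents. Since \<open>J\<close> is idempotent, an inverse \<open>V\<close>
  of \<open>U\<close> can be slipped in between two copies of it:
  \<open>U W J = U (W J) V \<cdot> U J\<close>. The first factor is a conjugate of a product of idempotents, so the set is
  closed under multiplication (\<open>compressible_mult\<close>). It contains every invertible matrix that
  differs from the identity in a single row, because a row operation applied to vectors whose last
  coordinate is zero can be carried out by idempotents: write the new entry into the free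
  coordinate, copy it to its destination, and erase the free coordinate
  (\<open>row_op_drop_last_product\<close>). With \<open>GE\<^sub>2\<close>, it therefore contains every invertible
  \<open>2 \<times> 2\<close> matrix acting on two coordinates (\<open>embed_compressible\<close>).

  Over a left Bezout domain such \<open>2 \<times> 2\<close> matrices suffice for Gaussian elimination: the left
  syzygies of a nonzero pair \<open>(a, b)\<close> form a free module of rank one, and a generator completes the
  coefficients of a Bezout identity to an invertible matrix taking \<open>(a, b)\<close> to \<open>(d, 0)\<close>
  (\<open>annihilate_pair\<close>).

  Now let \<open>A B = 0\<close> with \<open>B \<noteq> 0\<close>. Elimination turns a nonzero column of \<open>B\<close> into a multiple of the
  last unit vector, and in these coordinates \<open>A\<close> has a vanishing last column, because there are no
  zero divisors. A second elimination writes this conjugate of \<open>A\<close> as \<open>W T = W J T\<close>, where \<open>W J\<close> is a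
  product of idempotents and \<open>T\<close> is upper triangular with vanishing last row and column. Such a \<open>T\<close> is
  built from \<open>J\<close> by installing its rows one at a time, each by a row operation of the kind above
  (\<open>upper_triangular_product\<close>).

  Finally, stable range one implies \<open>GE\<^sub>2\<close>: the first row \<open>(x, y)\<close> of an invertible matrix generates
  the unit right ideal, so one column operation makes its first entry a unit, and the matrix then
  factors as lower triangular, diagonal, upper triangular (\<open>stable_range_1_GE_2\<close>).
\<close>

text \<open>Entries of products are computed with the formulas below for row operations;
  unfolding them into scalar products would hide the factors.\<close>

declare index_mult_mat(1) [simp del]

section \<open>Products and inverses of square matrices\<close>

lemma index_mult_mat_sum:
  fixes A B :: "'a::semiring_0 mat"
  assumes "A \<in> carrier_mat n m" "B \<in> carrier_mat m p" "i < n" "j < p"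
  shows "(A * B) $$ (i, j) = (\<Sum>s<m. A $$ (i, s) * B $$ (s, j))"
  using assms by (simp add: index_mult_mat(1) scalar_prod_def lessThan_atLeast0)

lemma invertible_matE:
  fixes A :: "'a::semiring_1 mat"
  assumes "invertible_mat A" "A \<in> carrier_mat n n"
  obtains B where "B \<in> carrier_mat n n" "A * B = 1\<^sub>m n" "B * A = 1\<^sub>m n"
proof -
  obtain B where B: "A * B = 1\<^sub>m (dim_row A)" "B * A = 1\<^sub>m (dim_row B)"
    using assms(1) unfolding invertible_mat_def inverts_mat_def by blast
  have "dim_col B = n" using arg_cong[OF B(1), of dim_col] assms(2) by simp
  moreover have "dim_row B = n" using arg_cong[OF B(2), of dim_col] assms(2) by simp
  ultimately show thesis using that[of B] B assms(2) by auto
qed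

lemma invertible_matI:
  fixes A :: "'a::semiring_1 mat"
  assumes "A \<in> carrier_mat n n" "B \<in> carrier_mat n n" "A * B = 1\<^sub>m n" "B * A = 1\<^sub>m n"
  shows "invertible_mat A"
  using assms unfolding invertible_mat_def inverts_mat_def by auto

lemma invertible_mat_mult:
  fixes A B :: "'a::semiring_1 mat"
  assumes "invertible_mat A" "A \<in> carrier_mat n n" "invertible_mat B" "B \<in> carrier_mat n n"
  shows "invertible_mat (A * B)"
proof -
  obtain A' where A': "A' \<in> carrier_mat n n" "A * A' = 1\<^sub>m n" "A' * A = 1\<^sub>m n"
    using invertible_matE assms(1,2) .
  obtain B' where B': "B' \<in> carrier_mat n n" "B * B' = 1\<^sub>m n" "B' * B = 1\<^sub>m n"
    using invertible_matE assms(3,4) .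
  have "A * B * (B' * A') = A * (B * B') * A'" "B' * A' * (A * B) = B' * (A' * A) * B"
    using assms(2,4) A'(1) B'(1) by (simp_all add: assoc_mult_mat[of _ n n _ n _ n])
  moreover have "A * (B * B') * A' = 1\<^sub>m n" "B' * (A' * A) * B = 1\<^sub>m n"
    using assms A' B' by (metis right_mult_one_mat)+
  ultimately have "A * B * (B' * A') = 1\<^sub>m n" "B' * A' * (A * B) = 1\<^sub>m n"
    by metis+
  then show ?thesis
    using invertible_matI mult_carrier_mat assms(2,4) A'(1) B'(1) by metis
qed

lemma product_of_carrier:
  assumes "S \<subseteq> carrier_mat n n" "product_of n S A"
  shows "A \<in> carrier_mat n n"
proof -
  have "set As \<subseteq> S \<Longrightarrow> foldr (*) As (1\<^sub>m n) \<in> carrier_mat n n" for As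
    using assms(1) by (induction As) auto
  then show ?thesis using assms(2) unfolding product_of_def by blast
qed

lemma product_of_single:
  assumes "A \<in> S" "A \<in> carrier_mat n n"
  shows "product_of n S A"
  unfolding product_of_def using assms by (intro exI[of _ "[A]"]) auto

lemma product_of_mult:
  assumes S: "S \<subseteq> carrier_mat n n" and "product_of n S A" "product_of n S B"
  shows "product_of n S (A * B)"
proof -
  obtain As Bs where As: "set As \<subseteq> S" "A = foldr (*) As (1\<^sub>m n)"
    and Bs: "set Bs \<subseteq> S" "B = foldr (*) Bs (1\<^sub>m n)"
    using assms(2,3) unfolding product_of_def by auto
  have *: "set Cs \<subseteq> S \<Longrightarrow> foldr (*) Cs (1\<^sub>m n) \<in> carrier_mat n n" for Cs
    using S by (induction Cs) auto
  have "set As \<subseteq> S \<Longrightarrow> foldr (*) As (1\<^sub>m n) * B = foldr (*) (As @ Bs) (1\<^sub>m n)"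
    using S *[OF Bs(1)] Bs(2) *
    by (induction As) (auto simp: subset_iff assoc_mult_mat[of _ n n _ n _ n])
  then show ?thesis
    unfolding product_of_def using As Bs by (intro exI[of _ "As @ Bs"]) auto
qed

lemma idempotent_mats_carrier: "idempotent_mats n \<subseteq> carrier_mat n n"
  by (auto simp: idempotent_mats_def)

text \<open>Conjugation is multiplicative, so it can be applied to each factor separately.\<close>

lemma product_of_idempotents_conjugate:
  assumes A: "product_of n (idempotent_mats n) A"
    and U: "U \<in> carrier_mat n n" "V \<in> carrier_mat n n" "U * V = 1\<^sub>m n" "V * U = 1\<^sub>m n"
  shows "product_of n (idempotent_mats n) (U * A * V)"
proof -
  have conj_mult: "U * (B * C) * V = (U * B * V) * (U * C * V)"
    if "B \<in> carrier_mat n n" "C \<in> carrier_mat n n" for B C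
  proof -
    have "(U * B * V) * (U * C * V) = U * B * (V * U) * C * V"
      using that U(1,2) by (simp add: assoc_mult_mat[of _ n n _ n _ n])
    then show ?thesis using that U by (simp add: assoc_mult_mat[of _ n n _ n _ n])
  qed
  have "product_of n (idempotent_mats n) (U * foldr (*) As (1\<^sub>m n) * V)"
    if "set As \<subseteq> idempotent_mats n" for As
    using that
  proof (induction As)
    case Nil
    then show ?case using U by (auto simp: product_of_def intro: exI[of _ "[]"])
  next
    case (Cons E As)
    have E: "E \<in> carrier_mat n n" "E * E = E"
      using Cons.prems by (auto simp: idempotent_mats_def)
    have "foldr (*) As (1\<^sub>m n) \<in> carrier_mat n n"
      using Cons.prems idempotent_mats_carrier
      by (intro product_of_carrier[of "idempotent_mats n"]) (auto simp: product_of_def)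
    then have "U * foldr (*) (E # As) (1\<^sub>m n) * V
        = (U * E * V) * (U * foldr (*) As (1\<^sub>m n) * V)"
      using conj_mult E by simp
    moreover have "U * E * V \<in> idempotent_mats n"
      using E U conj_mult[OF E(1) E(1)] by (auto simp: idempotent_mats_def)
    ultimately show ?case
      using Cons idempotent_mats_carrier product_of_mult product_of_single
      by (metis list.set_intros(2) subset_iff)
  qed
  then show ?thesis using A unfolding product_of_def by blast
qed

section \<open>Row operations that use a vanishing coordinate\<close>

text \<open>The identity matrix with row \<open>k\<close> replaced by \<open>f\<close>. Elementary matrices, diagonal matrices with
  one nontrivial entry and the projection \<open>J\<close> all have this form.\<close>

definition row_op :: "nat \<Rightarrow> nat \<Rightarrow> (nat \<Rightarrow> 'a::ring_1) \<Rightarrow> 'a mat" where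
  "row_op n k f = mat n n (\<lambda>(r, l). if r = k then f l else if r = l then 1 else 0)"

lemma row_op_carrier [simp]: "row_op n k f \<in> carrier_mat n n"
  by (simp add: row_op_def)

lemma row_op_dim [simp]: "dim_row (row_op n k f) = n" "dim_col (row_op n k f) = n"
  by (simp_all add: row_op_def)

lemma row_op_mult:
  fixes X :: "'a::ring_1 mat"
  assumes "X \<in> carrier_mat n m" "r < n" "l < m"
  shows "(row_op n k f * X) $$ (r, l) =
    (if r = k then \<Sum>s<n. f s * X $$ (s, l) else X $$ (r, l))"
proof -
  have "(row_op n k f * X) $$ (r, l) = (\<Sum>s<n. row_op n k f $$ (r, s) * X $$ (s, l))"
    using assms by (intro index_mult_mat_sum) auto
  also have "\<dots> = (\<Sum>s<n. if r = k then f s * X $$ (s, l) else if s = r then X $$ (s, l) else 0)"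
    using assms by (intro sum.cong) (auto simp: row_op_def)
  also have "\<dots> = (if r = k then \<Sum>s<n. f s * X $$ (s, l) else X $$ (r, l))"
    using assms by auto
  finally show ?thesis .
qed

lemma sum_mult_row_op:
  fixes f g :: "nat \<Rightarrow> 'a::ring_1"
  assumes "k < n" "l < n"
  shows "(\<Sum>s<n. f s * row_op n k g $$ (s, l)) = f k * g l + (if l = k then 0 else f l)"
proof -
  have "(\<Sum>s<n. f s * row_op n k g $$ (s, l))
      = (\<Sum>s<n. (if s = k then f k * g l else 0) + (if s = l then (if l = k then 0 else f l) else 0))"
    using assms by (intro sum.cong) (auto simp: row_op_def)
  then show ?thesis using assms by (simp add: sum.distrib)
qed

lemma row_op_mult_row_op_same:
  fixes f g :: "nat \<Rightarrow> 'a::ring_1"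
  assumes "k < n"
  shows "row_op n k f * row_op n k g = row_op n k (\<lambda>l. f k * g l + (if l = k then 0 else f l))"
proof (rule eq_matI)
  fix r l assume "r < dim_row (row_op n k (\<lambda>l. f k * g l + (if l = k then 0 else f l)))"
    "l < dim_col (row_op n k (\<lambda>l. f k * g l + (if l = k then 0 else f l)))"
  then have "r < n" "l < n" by auto
  then show "(row_op n k f * row_op n k g) $$ (r, l)
      = row_op n k (\<lambda>l. f k * g l + (if l = k then 0 else f l)) $$ (r, l)"
    using assms by (subst row_op_mult[of _ n n]) (auto simp: sum_mult_row_op, auto simp: row_op_def)
qed auto

text \<open>When \<open>f\<close> ignores coordinate \<open>k\<close>, overwriting coordinate \<open>k\<close> a second time stores the same
  value again.\<close>

lemma row_op_idempotent:
  assumes "k < n" "f k = 0"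
  shows "row_op n k f \<in> idempotent_mats n"
proof -
  have "(\<lambda>l. f k * f l + (if l = k then 0 else f l)) = f"
    using assms(2) by auto
  then show ?thesis
    using row_op_mult_row_op_same[OF assms(1), of f f] by (simp add: idempotent_mats_def)
qed

lemma row_op_invertible:
  fixes f :: "nat \<Rightarrow> 'a::ring_1"
  assumes "k < n" "invertible_elem (f k)"
  shows "invertible_mat (row_op n k f)"
proof -
  obtain u where u: "f k * u = 1" "u * f k = 1"
    using assms(2) by (auto simp: invertible_elem_def)
  \<comment> \<open>To undo \<open>x\<^sub>k := \<Sum> f\<^sub>l x\<^sub>l\<close>, subtract the terms with \<open>l \<noteq> k\<close> and divide by \<open>f\<^sub>k\<close> on the left.\<close>
  define g where "g = (\<lambda>l. if l = k then u else - (u * f l))"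
  define e where "e = (\<lambda>l. if l = k then 1 else 0 :: 'a)"
  have "f k * (- (u * f l)) = - f l" for l
    using u by (metis minus_mult_right mult.assoc mult_1)
  then have "(\<lambda>l. f k * g l + (if l = k then 0 else f l)) = e"
    by (auto simp: g_def e_def u)
  moreover have "(\<lambda>l. g k * f l + (if l = k then 0 else g l)) = e"
    by (auto simp: g_def e_def u)
  moreover have "row_op n k e = 1\<^sub>m n"
    by (rule eq_matI) (auto simp: row_op_def e_def)
  ultimately show ?thesis
    using row_op_mult_row_op_same[OF assms(1), of f g] row_op_mult_row_op_same[OF assms(1), of g f]
    by (intro invertible_matI[of _ n "row_op n k g"]) auto
qed

definition drop_last :: "nat \<Rightarrow> 'a::ring_1 mat" where
  "drop_last n = row_op n (n - 1) (\<lambda>_. 0)"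

lemma drop_last_carrier [simp]: "drop_last n \<in> carrier_mat n n"
  by (simp add: drop_last_def)

lemma drop_last_mult:
  fixes X :: "'a::ring_1 mat"
  assumes "X \<in> carrier_mat n m" "\<And>l. l < m \<Longrightarrow> X $$ (n - 1, l) = 0"
  shows "drop_last n * X = X"
  using assms by (intro eq_matI) (auto simp: drop_last_def row_op_mult[of _ n m])

text \<open>The last coordinate serves as scratch space. For \<open>k < n - 1\<close> the map
  \<open>(x, 0) \<mapsto> (x[k := f x], 0)\<close> is the composite
  \<open>(x, z) \<mapsto> (x, f x)\<close>, then \<open>(x, z) \<mapsto> (x[k := z], z)\<close>, then \<open>(x, z) \<mapsto> (x, 0)\<close>.
  Each of these overwrites one coordinate with a value that does not depend on it, so each is
  idempotent. The entry \<open>f k\<close> is arbitrary: this one trick covers elementary operations, and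
  scalings by any element of the ring.\<close>

lemma row_op_drop_last_product:
  fixes f :: "nat \<Rightarrow> 'a::ring_1"
  assumes k: "k < n"
  shows "product_of n (idempotent_mats n) (row_op n k f * drop_last n)"
proof -
  define t where "t = n - 1"
  have t: "t < n" using k by (simp add: t_def)
  \<comment> \<open>After the projection the last coordinate is zero, so \<open>f\<close> may be made to ignore it.\<close>
  define f' where "f' = f(t := 0)"
  have idem: "product_of n (idempotent_mats n) (row_op n j g)" if "j < n" "g j = 0"
    for j and g :: "nat \<Rightarrow> 'a"
    using that by (intro product_of_single row_op_idempotent) auto
  have J: "drop_last n = row_op n t (\<lambda>_. 0 :: 'a)"
    by (simp add: drop_last_def t_def)
  show ?thesis
  proof (cases "k = t")
    case True
    have "row_op n k f * drop_last n = row_op n t f'"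
      unfolding J True row_op_mult_row_op_same[OF t]
      by (rule arg_cong[of _ _ "row_op n t"]) (auto simp: f'_def)
    then show ?thesis using idem[of t f'] t by (simp add: f'_def)
  next
    case False
    define e where "e = (\<lambda>l. if l = t then 1 else 0 :: 'a)"
    define P where "P = row_op n t f'"
    have P: "P \<in> carrier_mat n n" by (simp add: P_def)
    have "row_op n k f * drop_last n = drop_last n * (row_op n k e * P)"
    proof (rule eq_matI)
      fix r l assume "r < dim_row (drop_last n * (row_op n k e * P))"
        "l < dim_col (drop_last n * (row_op n k e * P))"
      then have rl: "r < n" "l < n" by (auto simp: J P_def)
      have e: "(\<Sum>s<n. e s * P $$ (s, l)) = f' l"
        unfolding P_def using rl t by (subst sum_mult_row_op) (auto simp: e_def f'_def)
      have f: "(\<Sum>s<n. f s * drop_last n $$ (s, l)) = f' l"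
        unfolding J using rl t by (subst sum_mult_row_op) (auto simp: f'_def)
      have J_index: "(drop_last n * X) $$ (r, l) = (if r = t then 0 else X $$ (r, l))"
        if "X \<in> carrier_mat n n" for X :: "'a mat"
        unfolding J using rl that by (simp add: row_op_mult[of _ n n])
      have "(row_op n k f * drop_last n) $$ (r, l)
          = (if r = k then f' l else if r = t then 0 else if r = l then 1 else 0)"
        using rl f by (subst row_op_mult[of _ n n]) (auto simp: drop_last_def t_def row_op_def)
      also have "\<dots> = (if r = t then 0 else if r = k then f' l else P $$ (r, l))"
        using rl False by (auto simp: P_def row_op_def)
      also have "\<dots> = (drop_last n * (row_op n k e * P)) $$ (r, l)"
        using J_index[OF mult_carrier_mat[OF row_op_carrier P]] rl e P
        by (simp add: row_op_mult[of _ n n])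
      finally show "(row_op n k f * drop_last n) $$ (r, l)
          = (drop_last n * (row_op n k e * P)) $$ (r, l)" .
    qed (auto simp: J P_def)
    moreover have "product_of n (idempotent_mats n) P"
      unfolding P_def using t by (intro idem) (auto simp: f'_def)
    moreover have "product_of n (idempotent_mats n) (row_op n k e)"
      using k False by (intro idem) (auto simp: e_def)
    moreover have "product_of n (idempotent_mats n) (drop_last n :: 'a mat)"
      unfolding J using t by (intro idem) auto
    ultimately show ?thesis
      using product_of_mult[OF idempotent_mats_carrier] by metis
  qed
qed

section \<open>Invertible matrices applied to the coordinate hyperplane\<close>

definition compressible :: "nat \<Rightarrow> 'a::ring_1 mat set" where
  "compressible n = {U \<in> carrier_mat n n. invertible_mat U \<and>
     product_of n (idempotent_mats n) (U * drop_last n)}"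

text \<open>From \<open>J = J J\<close> and \<open>V U = 1\<close> follows \<open>U W J = U (W J) V \<cdot> U J\<close>.\<close>

lemma compressible_mult:
  fixes U W :: "'a::ring_1 mat"
  assumes "n > 0" "U \<in> compressible n" "W \<in> compressible n"
  shows "U * W \<in> compressible n"
proof -
  have U: "U \<in> carrier_mat n n" "invertible_mat U" "product_of n (idempotent_mats n) (U * drop_last n)"
    and W: "W \<in> carrier_mat n n" "invertible_mat W" "product_of n (idempotent_mats n) (W * drop_last n)"
    using assms by (auto simp: compressible_def)
  obtain V where V: "V \<in> carrier_mat n n" "U * V = 1\<^sub>m n" "V * U = 1\<^sub>m n"
    using invertible_matE U(2,1) .
  define J where "J = (drop_last n :: 'a mat)"
  have J: "J \<in> carrier_mat n n" by (simp add: J_def)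
  have "J * J = J"
    using row_op_idempotent[of "n - 1" n "\<lambda>_. 0 :: 'a"] assms(1)
    by (simp add: idempotent_mats_def J_def drop_last_def)
  then have "U * W * J = U * W * J * (V * U) * J"
    using U W J V by (simp add: assoc_mult_mat[of _ n n _ n _ n])
  also have "\<dots> = (U * (W * J) * V) * (U * J)"
    using U(1) W(1) J V(1) by (simp add: assoc_mult_mat[of _ n n _ n _ n])
  finally have *: "U * W * J = (U * (W * J) * V) * (U * J)" .
  have "product_of n (idempotent_mats n) (U * W * J)"
    unfolding * unfolding J_def
    by (intro product_of_mult[OF idempotent_mats_carrier]
        product_of_idempotents_conjugate[OF W(3) U(1) V] U(3))
  then show ?thesis
    using U W invertible_mat_mult by (auto simp: compressible_def J_def)
qed

lemma row_op_compressible: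
  assumes "k < n" "invertible_elem (f k)"
  shows "row_op n k f \<in> compressible n"
  using assms row_op_invertible row_op_drop_last_product by (auto simp: compressible_def)

lemma invertible_elem_1 [simp]: "invertible_elem 1"
  by (auto simp: invertible_elem_def)

lemma one_compressible:
  assumes "n > 0"
  shows "1\<^sub>m n \<in> compressible n"
proof -
  have "1\<^sub>m n = row_op n 0 (\<lambda>l. if l = 0 then 1 else 0 :: 'a)"
    by (rule eq_matI) (auto simp: row_op_def)
  then show ?thesis using row_op_compressible[OF assms, of "\<lambda>l. if l = 0 then 1 else 0 :: 'a"] by simp
qed

text \<open>The matrix \<open>Q\<close> acting on coordinates \<open>i\<close> and \<open>j\<close>, in this order, and the identity on the others.\<close>

definition embed :: "nat \<Rightarrow> nat \<Rightarrow> nat \<Rightarrow> 'a::ring_1 mat \<Rightarrow> 'a mat" where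
  "embed n i j Q = mat n n (\<lambda>(r, s).
     if r = i then (if s = i then Q $$ (0, 0) else if s = j then Q $$ (0, 1) else 0)
     else if r = j then (if s = i then Q $$ (1, 0) else if s = j then Q $$ (1, 1) else 0)
     else if r = s then 1 else 0)"

lemma embed_carrier [simp]: "embed n i j Q \<in> carrier_mat n n"
  by (simp add: embed_def)

lemma embed_mult_index:
  fixes X :: "'a::ring_1 mat"
  assumes "X \<in> carrier_mat n m" "i < n" "j < n" "i \<noteq> j" "r < n" "l < m"
  shows "(embed n i j Q * X) $$ (r, l) =
    (if r = i then Q $$ (0, 0) * X $$ (i, l) + Q $$ (0, 1) * X $$ (j, l)
     else if r = j then Q $$ (1, 0) * X $$ (i, l) + Q $$ (1, 1) * X $$ (j, l)
     else X $$ (r, l))"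
proof -
  define a b where "a = (if r = i then Q $$ (0, 0) else Q $$ (1, 0))"
    and "b = (if r = i then Q $$ (0, 1) else Q $$ (1, 1))"
  have "(embed n i j Q * X) $$ (r, l) = (\<Sum>s<n. embed n i j Q $$ (r, s) * X $$ (s, l))"
    using assms by (intro index_mult_mat_sum) auto
  also have "\<dots> = (\<Sum>s<n. if r = i \<or> r = j
      then (if s = i then a * X $$ (i, l) else 0) + (if s = j then b * X $$ (j, l) else 0)
      else if s = r then X $$ (r, l) else 0)"
    using assms by (intro sum.cong) (auto simp: embed_def a_def b_def)
  also have "\<dots> = (if r = i \<or> r = j then a * X $$ (i, l) + b * X $$ (j, l) else X $$ (r, l))"
    using assms by (simp add: sum.distrib)
  finally show ?thesis by (auto simp: a_def b_def)
qed

lemma index_mult_mat_2: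
  fixes A B :: "'a::semiring_0 mat"
  assumes "A \<in> carrier_mat 2 2" "B \<in> carrier_mat 2 2" "i < 2" "j < 2"
  shows "(A * B) $$ (i, j) = A $$ (i, 0) * B $$ (0, j) + A $$ (i, 1) * B $$ (1, j)"
  using index_mult_mat_sum[OF assms] by (simp add: numeral_2_eq_2)

lemma embed_mult_embed:
  assumes "P \<in> carrier_mat 2 2" "Q \<in> carrier_mat 2 2" "i < n" "j < n" "i \<noteq> j"
  shows "embed n i j (P * Q) = embed n i j P * embed n i j Q"
proof (rule eq_matI)
  fix r l assume "r < dim_row (embed n i j P * embed n i j Q)"
    "l < dim_col (embed n i j P * embed n i j Q)"
  then have "r < n" "l < n" by (auto simp: embed_def)
  then show "embed n i j (P * Q) $$ (r, l) = (embed n i j P * embed n i j Q) $$ (r, l)"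
    using assms
    by (subst embed_mult_index[of _ n n]) (auto simp: embed_def index_mult_mat_2)
qed (auto simp: embed_def)

lemma embed_one: "i \<noteq> j \<Longrightarrow> embed n i j (1\<^sub>m 2) = 1\<^sub>m n"
  by (rule eq_matI) (auto simp: embed_def)

lemma embed_elementary_compressible:
  assumes "E \<in> elementary_mats 2" "i < n" "j < n" "i \<noteq> j"
  shows "embed n i j E \<in> compressible n"
proof -
  obtain c p q where E: "E = 1\<^sub>m 2 + mat 2 2 (\<lambda>(k, l). if k = p \<and> l = q then c else 0)"
    and pq: "p < 2" "q < 2" "p \<noteq> q"
    using assms(1) by (auto simp: elementary_mats_def)
  \<comment> \<open>The two positions \<open>(0, 1)\<close> and \<open>(1, 0)\<close> for the off-diagonal entry exchange the roles of \<open>i\<close> and \<open>j\<close>.\<close>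
  define i' j' where "i' = (if p = 0 then i else j)" and "j' = (if p = 0 then j else i)"
  have "embed n i j E = row_op n i' (\<lambda>s. if s = i' then 1 else if s = j' then c else 0)"
    using assms pq
    by (intro eq_matI) (auto simp: embed_def row_op_def E i'_def j'_def less_2_cases_iff)
  then show ?thesis using assms by (auto simp: i'_def intro!: row_op_compressible)
qed

lemma embed_diagonal_compressible:
  assumes D: "D \<in> invertible_diagonal_mats 2" and "i < n" "j < n" "i \<noteq> j"
  shows "embed n i j D \<in> compressible n"
proof -
  have "D \<in> carrier_mat 2 2" "D $$ (0, 1) = 0" "D $$ (1, 0) = 0"
    and inv: "invertible_elem (D $$ (0, 0))" "invertible_elem (D $$ (1, 1))"
    using D by (auto simp: invertible_diagonal_mats_def diagonal_mat_def)
  moreover have "(\<Sum>s<n. (if s = p then a else 0) * h s) = a * h p"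
    if "p < n" for p and a :: 'a and h :: "nat \<Rightarrow> 'a"
  proof -
    have "(\<Sum>s<n. (if s = p then a else 0) * h s) = (\<Sum>s<n. if s = p then a * h p else 0)"
      by (intro sum.cong) auto
    then show ?thesis using that by simp
  qed
  ultimately have "embed n i j D = row_op n i (\<lambda>s. if s = i then D $$ (0, 0) else 0)
      * row_op n j (\<lambda>s. if s = j then D $$ (1, 1) else 0)"
    using assms
    by (intro eq_matI) (auto simp: embed_def row_op_mult[of _ n n], auto simp: row_op_def)
  then show ?thesis
    using assms inv by (auto intro!: compressible_mult row_op_compressible)
qed

lemma embed_compressible:
  fixes Q :: "'a::ring_1 mat"
  assumes "GE_2 TYPE('a)" "Q \<in> carrier_mat 2 2" "invertible_mat Q" and ij: "i < n" "j < n" "i \<noteq> j"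
  shows "embed n i j Q \<in> compressible n"
proof -
  let ?G = "elementary_mats 2 \<union> invertible_diagonal_mats 2 :: 'a mat set"
  have G: "?G \<subseteq> carrier_mat 2 2"
    by (auto simp: elementary_mats_def invertible_diagonal_mats_def)
  have "set Gs \<subseteq> ?G \<Longrightarrow> embed n i j (foldr (*) Gs (1\<^sub>m 2)) \<in> compressible n" for Gs
  proof (induction Gs)
    case Nil
    then show ?case using ij by (simp add: embed_one one_compressible)
  next
    case (Cons E Gs)
    have "foldr (*) Gs (1\<^sub>m 2) \<in> carrier_mat 2 2"
      using Cons.prems by (intro product_of_carrier[OF G]) (auto simp: product_of_def)
    then have "embed n i j (foldr (*) (E # Gs) (1\<^sub>m 2))
        = embed n i j E * embed n i j (foldr (*) Gs (1\<^sub>m 2))"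
      using Cons.prems G ij embed_mult_embed[of E "foldr (*) Gs (1\<^sub>m 2)" i n j] by auto
    moreover have "embed n i j E \<in> compressible n"
      using Cons.prems ij embed_elementary_compressible embed_diagonal_compressible by auto
    ultimately show ?case
      using Cons ij by (auto intro!: compressible_mult)
  qed
  moreover have "product_of 2 ?G Q"
    using assms(1-3) by (auto simp: GE_2_def)
  ultimately show ?thesis by (auto simp: product_of_def)
qed

section \<open>Clearing columns over a left Bezout domain\<close>

lemma left_bezout_pair:
  fixes a b :: "'a::ring_1"
  assumes "left_bezout TYPE('a)"
  obtains d x y a' b' where "d = x * a + y * b" "a = a' * d" "b = b' * d"
proof -
  obtain d where d: "left_ideal hull {a, b} = left_ideal hull {d}"
    using assms unfolding left_bezout_def by (metis finite.emptyI finite_insert)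
  let ?I = "{x * a + y * b |x y. True}" and ?J = "{x * d |x. True}"
  have "left_ideal ?I"
    unfolding left_ideal_def
  proof (intro conjI ballI allI)
    have "0 = 0 * a + 0 * b" by simp
    then show "0 \<in> ?I" by blast
  next
    fix u v assume "u \<in> ?I" "v \<in> ?I"
    then obtain x y x' y' where "u = x * a + y * b" "v = x' * a + y' * b" by blast
    then have "u + v = (x + x') * a + (y + y') * b" by (simp add: algebra_simps)
    then show "u + v \<in> ?I" by blast
  next
    fix u r assume "u \<in> ?I"
    then obtain x y where "u = x * a + y * b" by blast
    then have "r * u = (r * x) * a + (r * y) * b" by (simp add: algebra_simps)
    then show "r * u \<in> ?I" by blast
  qed
  moreover have "{a, b} \<subseteq> ?I"
  proof -
    have "a = 1 * a + 0 * b" "b = 0 * a + 1 * b" by simp_all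
    then show ?thesis by blast
  qed
  ultimately have "d \<in> ?I"
    using d hull_minimal[of "{a, b}" ?I left_ideal] hull_inc[of d "{d}" left_ideal] by auto
  moreover have "left_ideal ?J"
    unfolding left_ideal_def
  proof (intro conjI ballI allI)
    show "0 \<in> ?J" by (auto intro: exI[of _ 0])
  next
    fix u v assume "u \<in> ?J" "v \<in> ?J"
    then obtain x x' where "u = x * d" "v = x' * d" by blast
    then have "u + v = (x + x') * d" by (simp add: algebra_simps)
    then show "u + v \<in> ?J" by blast
  next
    fix u r assume "u \<in> ?J"
    then obtain x where "u = x * d" by blast
    then have "r * u = (r * x) * d" by (simp add: algebra_simps)
    then show "r * u \<in> ?J" by blast
  qed
  moreover have "{d} \<subseteq> ?J"
  proof -
    have "d = 1 * d" by simp
    then show ?thesis by blast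
  qed
  ultimately have "a \<in> ?J" "b \<in> ?J"
    using d hull_minimal[of "{d}" ?J left_ideal] hull_inc[of _ "{a, b}" left_ideal] by auto
  then show thesis using \<open>d \<in> ?I\<close> that by blast
qed

definition mat2 :: "'a \<Rightarrow> 'a \<Rightarrow> 'a \<Rightarrow> 'a \<Rightarrow> 'a::ring_1 mat" where
  "mat2 a b c d = mat 2 2 (\<lambda>(r, s). if r = 0 then (if s = 0 then a else b) else (if s = 0 then c else d))"

lemma mat2_carrier [simp]: "mat2 a b c d \<in> carrier_mat 2 2"
  by (simp add: mat2_def)

lemma mat2_index [simp]:
  "mat2 a b c d $$ (0, 0) = a" "mat2 a b c d $$ (0, Suc 0) = b"
  "mat2 a b c d $$ (Suc 0, 0) = c" "mat2 a b c d $$ (Suc 0, Suc 0) = d"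
  by (simp_all add: mat2_def)

lemma mat2_eqI:
  assumes "A \<in> carrier_mat 2 2" "A $$ (0, 0) = a" "A $$ (0, 1) = b" "A $$ (1, 0) = c" "A $$ (1, 1) = d"
  shows "A = mat2 a b c d"
  using assms by (intro eq_matI) (auto simp: mat2_def less_2_cases_iff)

lemma mat2_mult:
  "mat2 a b c d * mat2 a' b' c' d'
    = mat2 (a * a' + b * c') (a * b' + b * d') (c * a' + d * c') (c * b' + d * d')"
  by (rule mat2_eqI) (auto simp: index_mult_mat_2 intro!: mult_carrier_mat[of _ 2 2])

lemma mat2_one: "mat2 1 0 0 1 = 1\<^sub>m 2"
  by (rule mat2_eqI[symmetric]) auto

text \<open>Let \<open>R d = R a + R b\<close> with \<open>d = x a + y b\<close>, \<open>a = a' d\<close>, \<open>b = b' d\<close> and \<open>b \<noteq> 0\<close>, so that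
  \<open>x a' + y b' = 1\<close>. The left module \<open>K\<close> of all \<open>(s, t)\<close> with \<open>s a' + t b' = 0\<close> is a direct summand of
  \<open>R\<^sup>2\<close>, the projections of the unit vectors being \<open>(1 - a' x, - a' y)\<close> and \<open>(- b' x, 1 - b' y)\<close>. As
  \<open>b'\<close> is not a zero divisor, the first coordinate embeds \<open>K\<close> into \<open>R\<close>, and the image is a left
  ideal with two generators, hence principal. So \<open>K = R (z, w)\<close>, and the rows \<open>(x, y)\<close> and
  \<open>(z, w)\<close> are a basis of \<open>R\<^sup>2\<close>; the inverse matrix has rows \<open>(a', p)\<close> and \<open>(b', q)\<close>, where \<open>p\<close> and \<open>q\<close> are
  the coordinates of the two projections with respect to \<open>(z, w)\<close>.\<close>

lemma annihilate_pair:
  fixes a b :: "'a::ring_1_no_zero_divisors"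
  assumes bez: "left_bezout TYPE('a)"
  obtains P Q where "P \<in> carrier_mat 2 2" "Q \<in> carrier_mat 2 2"
    "P * Q = 1\<^sub>m 2" "Q * P = 1\<^sub>m 2" "Q $$ (1, 0) * a + Q $$ (1, 1) * b = 0"
proof (cases "b = 0")
  case True
  then show thesis using that[of "1\<^sub>m 2" "1\<^sub>m 2"] by simp
next
  case b: False
  obtain d x y a' b' where d: "d = x * a + y * b" and a': "a = a' * d" and b': "b = b' * d"
    using left_bezout_pair[OF bez] .
  have "d \<noteq> 0" "b' \<noteq> 0" using b b' by auto
  have "(x * a' + y * b' - 1) * d = 0"
    using d a' b' by (simp add: algebra_simps)
  then have xy: "x * a' + y * b' = 1" using \<open>d \<noteq> 0\<close> by simp
  \<comment> \<open>\<open>z\<close> generates the ideal of first coordinates of \<open>K\<close>.\<close>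
  obtain z \<alpha> \<beta> p q where z: "z = \<alpha> * (1 - a' * x) + \<beta> * (- b' * x)"
    and p: "1 - a' * x = p * z" and q: "- b' * x = q * z"
    using left_bezout_pair[OF bez] .
  define w where "w = \<alpha> * (- a' * y) + \<beta> * (1 - b' * y)"
  have xya: "c * x * a' + c * y * b' = c" for c
    using xy by (metis distrib_left mult.assoc mult.right_neutral)
  have zw: "z * a' + w * b' = 0"
  proof -
    have "z * a' + w * b' = \<alpha> * (a' - (a' * x * a' + a' * y * b')) + \<beta> * (b' - (b' * x * a' + b' * y * b'))"
      unfolding z w_def by (simp add: algebra_simps)
    then show ?thesis unfolding xya by simp
  qed
  \<comment> \<open>Elements of \<open>K\<close> are determined by their first coordinates.\<close>
  have inj: "c * w = e" if "c * z * a' + e * b' = 0" for c e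
  proof -
    have "(c * w - e) * b' = c * (z * a' + w * b') - (c * z * a' + e * b')"
      by (simp add: algebra_simps)
    then show ?thesis using that zw \<open>b' \<noteq> 0\<close> by simp
  qed
  have pw: "p * w = - a' * y"
  proof (rule inj)
    have "p * z * a' + - a' * y * b' = a' - (a' * x * a' + a' * y * b')"
      unfolding p[symmetric] by (simp add: algebra_simps)
    then show "p * z * a' + - a' * y * b' = 0" unfolding xya by simp
  qed
  have qw: "q * w = 1 - b' * y"
  proof (rule inj)
    have "q * z * a' + (1 - b' * y) * b' = b' - (b' * x * a' + b' * y * b')"
      unfolding q[symmetric] by (simp add: algebra_simps)
    then show "q * z * a' + (1 - b' * y) * b' = 0" unfolding xya by simp
  qed
  \<comment> \<open>The zero pair cannot generate \<open>K\<close>, so equations in \<open>R\<close> can be tested on \<open>(z, w)\<close>.\<close>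
  have nonzero: "z \<noteq> 0 \<or> w \<noteq> 0"
  proof (rule ccontr)
    assume "\<not> (z \<noteq> 0 \<or> w \<noteq> 0)"
    then have "1 - a' * x = 0" "- b' * x = 0" using p q by auto
    then show False using \<open>b' \<noteq> 0\<close> by auto
  qed
  then have cancel: "c = 0" if "c * z = 0" "c * w = 0" for c
    using that by auto
  have xpyq: "x * p + y * q = 0"
  proof (rule cancel)
    have "(x * p + y * q) * z = x * (1 - a' * x) + y * (- b' * x)"
      unfolding p q by (simp add: algebra_simps)
    also have "\<dots> = x - (x * a' + y * b') * x" by (simp add: algebra_simps)
    finally show "(x * p + y * q) * z = 0" using xy by simp
    have "(x * p + y * q) * w = x * (- a' * y) + y * (1 - b' * y)"
      unfolding pw[symmetric] qw[symmetric] by (simp add: algebra_simps)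
    also have "\<dots> = y - (x * a' + y * b') * y" by (simp add: algebra_simps)
    finally show "(x * p + y * q) * w = 0" using xy by simp
  qed
  have zpwq: "z * p + w * q - 1 = 0"
  proof (rule cancel)
    have "(z * p + w * q - 1) * z = z * (1 - a' * x) + w * (- b' * x) - z"
      unfolding p q by (simp add: algebra_simps)
    also have "\<dots> = - (z * a' + w * b') * x" by (simp add: algebra_simps)
    finally show "(z * p + w * q - 1) * z = 0" using zw by simp
    have "(z * p + w * q - 1) * w = z * (- a' * y) + w * (1 - b' * y) - w"
      unfolding pw[symmetric] qw[symmetric] by (simp add: algebra_simps)
    also have "\<dots> = - (z * a' + w * b') * y" by (simp add: algebra_simps)
    finally show "(z * p + w * q - 1) * w = 0" using zw by simp
  qed
  show thesis
  proof (rule that)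
    show "mat2 a' p b' q * mat2 x y z w = 1\<^sub>m 2"
      unfolding mat2_mult mat2_one[symmetric] pw qw p[symmetric] q[symmetric] by simp
    show "mat2 x y z w * mat2 a' p b' q = 1\<^sub>m 2"
      unfolding mat2_mult mat2_one[symmetric] xy zw xpyq using zpwq by simp
    have "z * a + w * b = (z * a' + w * b') * d"
      unfolding a' b' by (simp add: algebra_simps)
    then show "mat2 x y z w $$ (1, 0) * a + mat2 x y z w $$ (1, 1) * b = 0"
      using zw by simp
  qed auto
qed

text \<open>Elimination in column \<open>c\<close> with pivot row \<open>p\<close>, for the rows in \<open>S\<close>. The result is stated as a
  factorization \<open>X = U Y\<close> because \<open>compressible\<close> is not visibly closed under inverses: the factor that
  must lie in it is the one standing to the left of the reduced matrix. The last two clauses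
  (rows outside \<open>S\<close> are kept, columns that vanish on the active rows still do) let successive columns
  be treated without damaging the earlier ones.\<close>

lemma clear_column:
  fixes X :: "'a::ring_1_no_zero_divisors mat"
  assumes bez: "left_bezout TYPE('a)" and ge: "GE_2 TYPE('a)"
    and X: "X \<in> carrier_mat n m" and c: "c < m" and p: "p < n"
    and S: "finite S" "S \<subseteq> {..<n}" "p \<notin> S"
  shows "\<exists>U Y. U \<in> compressible n \<and> Y \<in> carrier_mat n m \<and> X = U * Y \<and>
    (\<forall>i\<in>S. Y $$ (i, c) = 0) \<and>
    (\<forall>k<n. k \<notin> insert p S \<longrightarrow> (\<forall>l<m. Y $$ (k, l) = X $$ (k, l))) \<and>
    (\<forall>l<m. (\<forall>i\<in>insert p S. X $$ (i, l) = 0) \<longrightarrow> (\<forall>i\<in>insert p S. Y $$ (i, l) = 0))"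
  using S
proof (induction S)
  case empty
  have "X = 1\<^sub>m n * X" using X by simp
  then show ?case using X p one_compressible[of n] by (intro exI[of _ "1\<^sub>m n"] exI[of _ X]) auto
next
  case (insert i S)
  then obtain U Y where U: "U \<in> compressible n" and Y: "Y \<in> carrier_mat n m" and UY: "X = U * Y"
    and clear: "\<forall>i\<in>S. Y $$ (i, c) = 0"
    and same: "\<forall>k<n. k \<notin> insert p S \<longrightarrow> (\<forall>l<m. Y $$ (k, l) = X $$ (k, l))"
    and vanish: "\<forall>l<m. (\<forall>i\<in>insert p S. X $$ (i, l) = 0) \<longrightarrow> (\<forall>i\<in>insert p S. Y $$ (i, l) = 0)"
    by auto
  have i: "i < n" "p \<noteq> i" "i \<notin> S" "S \<subseteq> {..<n}" "p \<notin> S" using insert by auto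
  obtain P Q where PQ: "P \<in> carrier_mat 2 2" "Q \<in> carrier_mat 2 2" "P * Q = 1\<^sub>m 2" "Q * P = 1\<^sub>m 2"
    and kill: "Q $$ (1, 0) * Y $$ (p, c) + Q $$ (1, 1) * Y $$ (i, c) = 0"
    using annihilate_pair[OF bez] .
  define Z where "Z = embed n p i Q * Y"
  have Z: "Z \<in> carrier_mat n m" unfolding Z_def using mult_carrier_mat[OF embed_carrier Y] .
  have Z_index: "Z $$ (r, l) =
      (if r = p then Q $$ (0, 0) * Y $$ (p, l) + Q $$ (0, 1) * Y $$ (i, l)
       else if r = i then Q $$ (1, 0) * Y $$ (p, l) + Q $$ (1, 1) * Y $$ (i, l)
       else Y $$ (r, l))" if "r < n" "l < m" for r l
    unfolding Z_def using embed_mult_index[OF Y p i(1,2) that] .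
  have inv: "invertible_mat P" using invertible_matI PQ by blast
  have "embed n p i P * Z = embed n p i (P * Q) * Y"
    unfolding Z_def using embed_mult_embed[OF PQ(1,2) p i(1,2)] Y
    by (simp add: assoc_mult_mat[of _ n n _ n _ m])
  then have PZ: "Y = embed n p i P * Z"
    using Y PQ(3) i(2) by (simp add: embed_one)
  have comp: "U * embed n p i P \<in> compressible n"
    using U p embed_compressible[OF ge PQ(1) inv p i(1,2)] by (intro compressible_mult) auto
  have "X = U * embed n p i P * Z"
    unfolding UY PZ using U Z by (simp add: compressible_def assoc_mult_mat[of _ n n _ n _ m])
  moreover have "\<forall>j\<in>insert i S. Z $$ (j, c) = 0"
    using clear kill i p c by (auto simp: Z_index subset_iff)
  moreover have "\<forall>k<n. k \<notin> insert p (insert i S) \<longrightarrow> (\<forall>l<m. Z $$ (k, l) = X $$ (k, l))"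
    using same by (auto simp: Z_index)
  moreover have "\<forall>l<m. (\<forall>j\<in>insert p (insert i S). X $$ (j, l) = 0) \<longrightarrow>
      (\<forall>j\<in>insert p (insert i S). Z $$ (j, l) = 0)"
    using vanish same i p by (auto simp: Z_index subset_iff)
  ultimately show ?case using comp Z by blast
qed

text \<open>Columns are treated from left to right with the pivot on the diagonal.\<close>

lemma triangularize:
  fixes X :: "'a::ring_1_no_zero_divisors mat"
  assumes bez: "left_bezout TYPE('a)" and ge: "GE_2 TYPE('a)"
    and X: "X \<in> carrier_mat n n" and "n > 0" "c \<le> n"
  shows "\<exists>U T. U \<in> compressible n \<and> T \<in> carrier_mat n n \<and> X = U * T \<and>
    (\<forall>l<c. \<forall>k<n. l < k \<longrightarrow> T $$ (k, l) = 0)"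
  using \<open>c \<le> n\<close>
proof (induction c)
  case 0
  have "X = 1\<^sub>m n * X" using X by simp
  then show ?case using X one_compressible[OF \<open>n > 0\<close>]
    by (intro exI[of _ "1\<^sub>m n"] exI[of _ X]) auto
next
  case (Suc c)
  then obtain U T where U: "U \<in> compressible n" and T: "T \<in> carrier_mat n n" "X = U * T"
    and tri: "\<forall>l<c. \<forall>k<n. l < k \<longrightarrow> T $$ (k, l) = 0"
    by auto
  have c: "c < n" using Suc by simp
  obtain W Y where W: "W \<in> compressible n" and Y: "Y \<in> carrier_mat n n" "T = W * Y"
    and clear: "\<forall>i\<in>{c<..<n}. Y $$ (i, c) = 0"
    and same: "\<forall>k<n. k \<notin> insert c {c<..<n} \<longrightarrow> (\<forall>l<n. Y $$ (k, l) = T $$ (k, l))"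
    and vanish: "\<forall>l<n. (\<forall>i\<in>insert c {c<..<n}. T $$ (i, l) = 0) \<longrightarrow>
      (\<forall>i\<in>insert c {c<..<n}. Y $$ (i, l) = 0)"
  proof -
    have "finite {c<..<n}" "{c<..<n} \<subseteq> {..<n}" "c \<notin> {c<..<n}" by auto
    from clear_column[OF bez ge T(1) c c this] show thesis using that by blast
  qed
  have "X = U * W * Y"
    unfolding T(2) Y(2) using U W Y(1) by (simp add: compressible_def assoc_mult_mat[of _ n n _ n _ n])
  moreover have "Y $$ (k, l) = 0" if lk: "l < Suc c" "k < n" "l < k" for l k
  proof (cases "l = c")
    case True
    then show ?thesis using clear lk by auto
  next
    case False
    then have l: "l < c" "l < n" using lk by auto
    show ?thesis
    proof (cases "k < c")
      case True
      then show ?thesis using same tri l lk by auto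
    next
      case False
      have "\<forall>i\<in>insert c {c<..<n}. T $$ (i, l) = 0" using tri l c by auto
      then have "\<forall>i\<in>insert c {c<..<n}. Y $$ (i, l) = 0" using vanish l by blast
      then show ?thesis using False lk by auto
    qed
  qed
  moreover have "U * W \<in> compressible n"
    using compressible_mult[OF \<open>n > 0\<close> U W] .
  ultimately show ?case using Y(1) by blast
qed

section \<open>Singular matrices as products of idempotents\<close>

text \<open>Start from \<open>J\<close> and install the rows of \<open>T\<close> from the top. When row \<open>k\<close> is installed, the rows from \<open>k\<close>
  on are still those of \<open>J\<close>, and by triangularity the row operation with coefficients \<open>T\<^sub>k\<^sub>l\<close>
  involves only these, so the new row is exactly row \<open>k\<close> of \<open>T\<close>. The last row remains zero, which
  allows a projection \<open>J\<close> to be inserted in front of every intermediate matrix.\<close>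

lemma upper_triangular_product:
  fixes T :: "'a::ring_1 mat"
  assumes T: "T \<in> carrier_mat n n" and n: "n > 0"
    and tri: "\<And>k l. l < k \<Longrightarrow> k < n \<Longrightarrow> T $$ (k, l) = 0"
    and last: "\<And>k. k < n \<Longrightarrow> T $$ (k, n - 1) = 0"
  shows "product_of n (idempotent_mats n) T"
proof -
  define R where "R k = mat n n (\<lambda>(r, l). if r < k then T $$ (r, l)
    else if r = l \<and> r \<noteq> n - 1 then 1 else 0)" for k
  have R: "R k \<in> carrier_mat n n" for k by (simp add: R_def)
  have "product_of n (idempotent_mats n) (R k)" if "k \<le> n - 1" for k
    using that
  proof (induction k)
    case 0
    have "R 0 = drop_last n"
      by (rule eq_matI) (auto simp: R_def drop_last_def row_op_def)
    moreover have "drop_last n \<in> idempotent_mats n"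
      unfolding drop_last_def using n by (intro row_op_idempotent) auto
    ultimately show ?case using product_of_single R by metis
  next
    case (Suc k)
    then have k: "k < n - 1" "k < n" by auto
    have drop: "drop_last n * R k = R k"
      using k by (intro drop_last_mult[OF R]) (auto simp: R_def)
    have "R (Suc k) = row_op n k (\<lambda>l. T $$ (k, l)) * R k"
    proof (rule eq_matI)
      fix r l assume "r < dim_row (row_op n k (\<lambda>l. T $$ (k, l)) * R k)"
        "l < dim_col (row_op n k (\<lambda>l. T $$ (k, l)) * R k)"
      then have rl: "r < n" "l < n" by (auto simp: R_def)
      have "(\<Sum>s<n. T $$ (k, s) * R k $$ (s, l)) = (\<Sum>s<n. if s = l then T $$ (k, l) else 0)"
        using rl k tri last by (intro sum.cong) (auto simp: R_def)
      also have "\<dots> = T $$ (k, l)" using rl by simp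
      finally show "R (Suc k) $$ (r, l) = (row_op n k (\<lambda>l. T $$ (k, l)) * R k) $$ (r, l)"
        using rl by (simp add: row_op_mult[OF R]) (auto simp: R_def)
    qed (auto simp: R_def)
    also have "\<dots> = row_op n k (\<lambda>l. T $$ (k, l)) * drop_last n * R k"
      using R drop by (simp add: assoc_mult_mat[of _ n n _ n _ n])
    finally show ?case
      using product_of_mult[OF idempotent_mats_carrier row_op_drop_last_product[OF k(2)]] Suc by simp
  qed
  moreover have "R (n - 1) = T"
    using T tri last by (intro eq_matI) (auto simp: R_def)
  ultimately show ?thesis by (metis order_refl)
qed

text \<open>A column of \<open>B\<close>, where \<open>A B = 0\<close>, supplies coordinates in which the last column of \<open>A\<close> vanishes;
  then the rest of \<open>A\<close> can be eliminated by multiplication from the left alone.\<close>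

lemma right_singular_product:
  fixes A :: "'a::ring_1_no_zero_divisors mat"
  assumes bez: "left_bezout TYPE('a)" and ge: "GE_2 TYPE('a)"
    and A: "A \<in> carrier_mat n n" and sing: "right_singular_mat n A"
  shows "product_of n (idempotent_mats n) A"
proof -
  obtain B where B: "B \<in> carrier_mat n n" "B \<noteq> 0\<^sub>m n n" "A * B = 0\<^sub>m n n"
    using sing by (auto simp: right_singular_mat_def)
  obtain r c where rc: "r < n" "c < n" "B $$ (r, c) \<noteq> 0"
  proof -
    have "\<exists>r<n. \<exists>c<n. B $$ (r, c) \<noteq> 0"
    proof (rule ccontr)
      assume "\<not> ?thesis"
      then have "B = 0\<^sub>m n n" using B(1) by (intro eq_matI) auto
      then show False using B(2) by simp
    qed
    then show thesis using that by blast
  qed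
  then have n: "n > 0" by simp
  obtain U Y where U: "U \<in> compressible n" and Y: "Y \<in> carrier_mat n n" "B = U * Y"
    and clear: "\<forall>i\<in>{..<n - 1}. Y $$ (i, c) = 0"
  proof -
    have "finite {..<n - 1}" "{..<n - 1} \<subseteq> {..<n}" "n - 1 \<notin> {..<n - 1}" "n - 1 < n"
      using n by auto
    from clear_column[OF bez ge B(1) rc(2) this(4,1-3)] show thesis using that by blast
  qed
  have Uc: "U \<in> carrier_mat n n" "invertible_mat U" using U by (auto simp: compressible_def)
  have col: "(M * Y) $$ (k, c) = M $$ (k, n - 1) * Y $$ (n - 1, c)"
    if M: "M \<in> carrier_mat n n" "k < n" for M k
  proof -
    have "(M * Y) $$ (k, c) = (\<Sum>s<n. if s = n - 1 then M $$ (k, n - 1) * Y $$ (n - 1, c) else 0)"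
      unfolding index_mult_mat_sum[OF M(1) Y(1) M(2) rc(2)]
      using clear by (intro sum.cong) auto
    then show ?thesis using n by simp
  qed
  have "Y $$ (n - 1, c) \<noteq> 0" using col[OF Uc(1) rc(1)] rc(3) Y(2) by auto
  moreover have "A * U * Y = 0\<^sub>m n n"
    using B Y A Uc by (simp add: assoc_mult_mat[of _ n n _ n _ n])
  ultimately have AU: "(A * U) $$ (k, n - 1) = 0" if "k < n" for k
    using col[OF mult_carrier_mat[OF A Uc(1)] that] that rc(2) by auto
  obtain V where V: "V \<in> carrier_mat n n" "U * V = 1\<^sub>m n" "V * U = 1\<^sub>m n"
    using invertible_matE Uc(2,1) .
  \<comment> \<open>A conjugate of \<open>A\<close> whose last column is zero.\<close>
  define C where "C = V * (A * U)"
  have C: "C \<in> carrier_mat n n" using V A Uc by (simp add: C_def)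
  obtain W T where W: "W \<in> compressible n" and T: "T \<in> carrier_mat n n" "C = W * T"
    and tri: "\<forall>l<n. \<forall>k<n. l < k \<longrightarrow> T $$ (k, l) = 0"
    using triangularize[OF bez ge C n order_refl] by blast
  have Wc: "W \<in> carrier_mat n n" "invertible_mat W" using W by (auto simp: compressible_def)
  obtain W' where W': "W' \<in> carrier_mat n n" "W * W' = 1\<^sub>m n" "W' * W = 1\<^sub>m n"
    using invertible_matE Wc(2,1) .
  have "W' * V * (A * U) = W' * (W * T)"
    unfolding T(2)[symmetric] C_def
    using W'(1) V(1) A Uc(1) by (simp add: assoc_mult_mat[of _ n n _ n _ n])
  also have "\<dots> = (W' * W) * T"
    using W'(1) Wc(1) T(1) by (simp add: assoc_mult_mat[of _ n n _ n _ n])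
  finally have "T = W' * V * (A * U)" using T(1) W'(3) by simp
  then have last: "T $$ (k, n - 1) = 0" if "k < n" for k
    using that W' V A Uc n AU
    by (simp add: index_mult_mat_sum[OF mult_carrier_mat[OF W'(1) V(1)] mult_carrier_mat[OF A Uc(1)]])
  \<comment> \<open>The last row is zero left of the diagonal by triangularity, and on it by \<open>last\<close>.\<close>
  have "T $$ (n - 1, l) = 0" if "l < n" for l
    using that tri last n by (cases "l = n - 1") auto
  then have "W * T = W * (drop_last n * T)"
    using drop_last_mult[OF T(1)] by simp
  also have "\<dots> = W * drop_last n * T"
    using Wc T by (simp add: assoc_mult_mat[of _ n n _ n _ n])
  finally have C_eq: "C = W * drop_last n * T" unfolding T(2) .
  have "product_of n (idempotent_mats n) T"
    using upper_triangular_product[OF T(1) n] tri last by auto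
  moreover have "product_of n (idempotent_mats n) (W * drop_last n)"
    using W by (simp add: compressible_def)
  ultimately have "product_of n (idempotent_mats n) C"
    unfolding C_eq using product_of_mult[OF idempotent_mats_carrier] by blast
  then have "product_of n (idempotent_mats n) (U * C * V)"
    using product_of_idempotents_conjugate Uc V by blast
  moreover have "U * C * V = A"
  proof -
    have "U * C * V = (U * V) * A * (U * V)"
      unfolding C_def using A Uc(1) V(1) by (simp add: assoc_mult_mat[of _ n n _ n _ n])
    then show ?thesis using A V by simp
  qed
  ultimately show ?thesis by simp
qed

section \<open>Stable range one\<close>

text \<open>If \<open>u = x + y t\<close> is a unit, the column operation with \<open>t\<close> puts \<open>u\<close> into the corner, and
  elimination with \<open>u\<close> as pivot leaves \<open>diag(u, v)\<close>; the Schur complement \<open>v\<close> is a unit because the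
  diagonal matrix is still invertible.\<close>

lemma stable_range_1_GE_2:
  assumes sr: "stable_range_1 TYPE('a::ring_1)"
  shows "GE_2 TYPE('a)"
  unfolding GE_2_def
proof (intro allI impI, elim conjE)
  fix Q :: "'a mat" assume Q: "Q \<in> carrier_mat 2 2" "invertible_mat Q"
  let ?G = "elementary_mats 2 \<union> invertible_diagonal_mats 2 :: 'a mat set"
  obtain P where P: "P \<in> carrier_mat 2 2" "Q * P = 1\<^sub>m 2" "P * Q = 1\<^sub>m 2"
    using invertible_matE Q(2,1) .
  define x y z w where "x = Q $$ (0, 0)" and "y = Q $$ (0, 1)" and "z = Q $$ (1, 0)" and "w = Q $$ (1, 1)"
  have Q_eq: "Q = mat2 x y z w"
    using Q(1) by (intro mat2_eqI) (auto simp: x_def y_def z_def w_def)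
  have "x * P $$ (0, 0) + y * P $$ (1, 0) = 1"
    using index_mult_mat_2[OF Q(1) P(1), of 0 0] P(2) by (simp add: x_def y_def)
  then have "c = x * (P $$ (0, 0) * c) + y * (P $$ (1, 0) * c)" for c
    by (metis distrib_right mult.assoc mult_1)
  then have "{x * r + y * s |r s. True} = UNIV" by blast
  then obtain t where "invertible_elem (x + y * t)"
    using sr unfolding stable_range_1_def by blast
  then obtain u u' where u: "u = x + y * t" "u * u' = 1" "u' * u = 1"
    by (auto simp: invertible_elem_def)
  define s where "s = z + w * t"
  define v where "v = w - s * u' * y"
  define L M N where "L = mat2 1 0 (s * u') 1" and "M = mat2 1 (u' * y) 0 1" and "N = mat2 1 0 (- t) 1"
  define L' M' N' where "L' = mat2 1 0 (- s * u') 1" and "M' = mat2 1 (- u' * y) 0 1" and "N' = mat2 1 0 t 1"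
  define D where "D = mat2 u 0 0 v"
  note defs = L_def M_def N_def L'_def M'_def N'_def D_def
  have uy: "u * (u' * y) = y" "s * u' * u = s"
    using u by (metis mult.assoc mult_1) (metis mult.assoc u(3) mult.right_neutral)
  have "L * D = mat2 u 0 s v" by (simp add: defs mat2_mult uy)
  then have "L * D * M = mat2 u y s w"
    by (simp add: mat2_mult uy M_def v_def mult.assoc)
  then have Q_prod: "L * D * M * N = Q"
    by (simp add: mat2_mult N_def Q_eq u s_def)
  have inv: "L' * L = 1\<^sub>m 2" "L * L' = 1\<^sub>m 2" "M' * M = 1\<^sub>m 2" "M * M' = 1\<^sub>m 2"
      "N' * N = 1\<^sub>m 2" "N * N' = 1\<^sub>m 2"
    by (simp_all add: defs mat2_mult mat2_one)
  have carr: "L \<in> carrier_mat 2 2" "M \<in> carrier_mat 2 2" "N \<in> carrier_mat 2 2"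
      "L' \<in> carrier_mat 2 2" "M' \<in> carrier_mat 2 2" "N' \<in> carrier_mat 2 2" "D \<in> carrier_mat 2 2"
    by (simp_all add: defs)
  have "L' * Q * N' * M' = (L' * L) * D * (M * (N * N') * M')"
    unfolding Q_prod[symmetric] using carr by (simp add: assoc_mult_mat[of _ 2 2 _ 2 _ 2])
  then have D_eq: "D = L' * Q * N' * M'" using carr inv by simp
  have "invertible_mat D"
    unfolding D_eq using carr inv Q invertible_matI
    by (intro invertible_mat_mult[of _ 2]) (auto intro!: mult_carrier_mat)
  then obtain E where E: "E \<in> carrier_mat 2 2" "D * E = 1\<^sub>m 2" "E * D = 1\<^sub>m 2"
    using invertible_matE carr(7) by blast
  have "v * E $$ (1, 1) = 1" "E $$ (1, 1) * v = 1"
    using index_mult_mat_2[OF carr(7) E(1), of 1 1] index_mult_mat_2[OF E(1) carr(7), of 1 1] E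
    by (simp_all add: D_def)
  then have "D \<in> ?G"
    using u by (auto simp: invertible_diagonal_mats_def diagonal_mat_def D_def less_2_cases_iff
        invertible_elem_def mat2_def)
  moreover have low: "mat2 1 0 c 1 \<in> ?G" and up: "mat2 1 c 0 1 \<in> ?G" for c :: 'a
  proof -
    have "mat2 1 0 c 1 = 1\<^sub>m 2 + mat 2 2 (\<lambda>(k, l). if k = 1 \<and> l = 0 then c else 0)"
      by (rule mat2_eqI[symmetric]) auto
    then show "mat2 1 0 c 1 \<in> ?G" unfolding elementary_mats_def by force
    have "mat2 1 c 0 1 = 1\<^sub>m 2 + mat 2 2 (\<lambda>(k, l). if k = 0 \<and> l = 1 then c else 0)"
      by (rule mat2_eqI[symmetric]) auto
    then show "mat2 1 c 0 1 \<in> ?G" unfolding elementary_mats_def by force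
  qed
  moreover have "?G \<subseteq> carrier_mat 2 2"
    by (auto simp: elementary_mats_def invertible_diagonal_mats_def)
  ultimately show "product_of 2 ?G Q"
    unfolding Q_prod[symmetric] using carr
    by (intro product_of_mult product_of_single) (auto simp: defs)
qed

theorem theorem22:
  assumes "bezout TYPE('a::ring_1_no_zero_divisors)"
  shows "(IP_2 TYPE('a) \<and> GE_2 TYPE('a) \<longrightarrow>
            (\<forall>n. \<forall>A :: 'a mat. A \<in> carrier_mat n n \<and> singular_mat n A \<longrightarrow>
               product_of n (idempotent_mats n) A))
         \<and> (stable_range_1 TYPE('a) \<longrightarrow> IP TYPE('a))"
  using assms right_singular_product stable_range_1_GE_2
  unfolding bezout_def IP_def IP_size_def singular_mat_def by blast

end
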